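(* Let $p\in(0,1)$, $\theta_1,\theta_2>0$ and $a,b>0$. Let $S_n=Z_1+\dots+Z_n$, $n=1,2,\dots$, be a random walk with i.i.d. steps $Z_i$ having probability density $f(x)=p\theta_1e^{-\theta_1x}$ for $x\ge 0$ and $f(x)=(1-p)\theta_2e^{\theta_2x}$ for $x<0$. Let $T=\inf\{n\ge 1:S_n\ge b\text{ or }S_n\le -a\}$ be the time until the random walk exits $(-a,b)$. Then the probability generating function of $T$ is, for $u\in(0,1)$, $$\mathbb{E}(u^{T})=\frac{\left(\frac{\theta_1-w_u}{\theta_1e^{w_ub}}-\frac{(\theta_2+w_u)e^{w_ua}}{\theta_2}\right)\left(1-\frac{(\theta_2+w_u)^{2}e^{-\beta_ua}}{u(1-p)\theta_2(\theta_1+\theta_2)}\right)}{\frac{(\theta_1-w_u)^{2}e^{\beta_ub}}{up\theta_1(\theta_1+\theta_2)}-\frac{(\theta_2+w_u)^{2}e^{-\beta_ua}}{u(1-p)\theta_2(\theta_1+\theta_2)}}+\frac{(\theta_2+w_u)e^{w_ua}}{\theta_2},$$ where $$\beta_u=-\sqrt{\left(\theta_1-\theta_2+u((1-p)\theta_2-p\theta_1)\right)^{2}+4(1-u)\theta_1\theta_2},$$ $$w_u=\tfrac12\left(\theta_1-\theta_2+u((1-p)\theta_2-p\theta_1)-\beta_u\right).$$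
   Context: The step $Z_i$ equals $X_i$ with probability $p$ and $-Y_i$ with probability $1-p$, where $X_i$ and $Y_i$ are exponentially distributed with parameters (rates) $\theta_1$ and $\theta_2$ respectively. *)

theory Defs
  imports "HOL-Probability.Probability"
begin

definition step_density :: "real \<Rightarrow> real \<Rightarrow> real \<Rightarrow> real \<Rightarrow> real" where
  "step_density p \<theta>1 \<theta>2 x =
     (if x \<ge> 0 then p * \<theta>1 * exp (- \<theta>1 * x) else (1 - p) * \<theta>2 * exp (\<theta>2 * x))"

text \<open>The steps are indexed from 1; \<open>Z 0\<close> is never used.\<close>

definition walk :: "(nat \<Rightarrow> 'a \<Rightarrow> real) \<Rightarrow> nat \<Rightarrow> 'a \<Rightarrow> real" where
  "walk Z n \<omega> = (\<Sum>i=1..n. Z i \<omega>)"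

text \<open>On \<^typ>\<open>enat\<close> the infimum of the empty set is \<open>\<infinity>\<close>, so the exit time is \<open>\<infinity>\<close>
  on paths that never leave the interval.\<close>

definition exit_time :: "(nat \<Rightarrow> 'a \<Rightarrow> real) \<Rightarrow> real \<Rightarrow> real \<Rightarrow> 'a \<Rightarrow> enat" where
  "exit_time Z a b \<omega> = Inf {enat n | n. n \<ge> 1 \<and> (walk Z n \<omega> \<ge> b \<or> walk Z n \<omega> \<le> - a)}"

text \<open>For \<open>0 < u < 1\<close> the convention is \<open>u ^ \<infinity> = 0\<close>.\<close>

definition power_enat :: "real \<Rightarrow> enat \<Rightarrow> real" where
  "power_enat u n = (case n of enat k \<Rightarrow> u ^ k | \<infinity> \<Rightarrow> 0)"

definition beta :: "real \<Rightarrow> real \<Rightarrow> real \<Rightarrow> real \<Rightarrow> real" where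
  "beta p \<theta>1 \<theta>2 u =
     - sqrt ((\<theta>1 - \<theta>2 + u * ((1 - p) * \<theta>2 - p * \<theta>1))\<^sup>2 + 4 * (1 - u) * \<theta>1 * \<theta>2)"

definition root_w :: "real \<Rightarrow> real \<Rightarrow> real \<Rightarrow> real \<Rightarrow> real" where
  "root_w p \<theta>1 \<theta>2 u =
     1 / 2 * (\<theta>1 - \<theta>2 + u * ((1 - p) * \<theta>2 - p * \<theta>1) - beta p \<theta>1 \<theta>2 u)"

end

theory Submission imports Defs
begin

text \<open>The formula rests on two facts: the exponential law is memoryless, so the overshoot at the
exit is known, and the exponentials \<open>exp (l * S n)\<close> are eigenfunctions of the random walk.

Let \<open>A\<close> and \<open>B\<close> be the parts of the expectation of \<open>u ^ T\<close> that come from an exit at the top and at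
the bottom. Given that the walk leaves through the top at time \<open>T\<close>, the overshoot \<open>S T - b\<close> is
exponential with rate \<open>\<theta>1\<close> and independent of \<open>T\<close>; hence the part of the expectation of
\<open>u ^ T * exp (l * S T)\<close> due to upper exits is \<open>\<theta>1 / (\<theta>1 - l) * exp (l * b) * A\<close>, and similarly below
(lemmas \<open>upper_exit_moment\<close> and \<open>lower_exit_moment\<close>). If \<open>u\<close> times the moment generating function of a
step is \<open>1\<close> at \<open>l\<close>, then \<open>u ^ n * exp (l * S n)\<close> is a martingale, bounded before the exit, so the
value at the exit has expectation \<open>1\<close>. This is one linear equation for \<open>A\<close> and \<open>B\<close>
(lemma \<open>exit_identity\<close>). The condition on \<open>l\<close> is a quadratic equation with the roots \<open>w\<close> and
\<open>w + \<beta>\<close>, both strictly between \<open>- \<theta>2\<close> and \<open>\<theta>1\<close> (lemma \<open>roots\<close>). The two equations determine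
\<open>A\<close> and \<open>B\<close>, and \<open>A + B\<close> is the expectation of \<open>u ^ T\<close>.

Optional stopping is carried out by hand. The moment \<open>E (exp (l * S n); T > n)\<close>, multiplied by
the step's moment generating function, splits into the same moment at \<open>n + 1\<close> and the two exit terms at time
\<open>n + 1\<close> (lemma \<open>alive_moment_recursion\<close>). Weighted with \<open>u ^ n\<close> these identities telescope, and the
remainder is at most \<open>u ^ n\<close> times a constant.\<close>

section \<open>Conditioning on an independent past\<close>

text \<open>Fubini for an independent pair whose second component enters only through a real function with a
density. Independence of two variables needs them to have one common type; the function \<open>h\<close> allows \<open>W\<close> to
be a one-point family of steps while \<open>X\<close> is the family of all earlier ones.\<close>

lemma (in prob_space) nn_integral_indep_density:
  fixes X W :: "'a \<Rightarrow> 'b" and h :: "'b \<Rightarrow> real"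
  assumes ind: "indep_var N X L W"
    and h[measurable]: "h \<in> borel_measurable L"
    and Y: "distributed M lborel (\<lambda>\<omega>. h (W \<omega>)) f"
    and g[measurable]: "g \<in> borel_measurable (N \<Otimes>\<^sub>M borel)"
  shows "(\<integral>\<^sup>+\<omega>. g (X \<omega>, h (W \<omega>)) \<partial>M) = (\<integral>\<^sup>+\<omega>. (\<integral>\<^sup>+y. f y * g (X \<omega>, y) \<partial>lborel) \<partial>M)"
proof -
  have X[measurable]: "X \<in> measurable M N" and W[measurable]: "W \<in> measurable M L"
    using ind by (auto dest: indep_var_rv1 indep_var_rv2)
  interpret D: prob_space "distr M L W" by (rule prob_space_distr) simp
  have "(\<integral>\<^sup>+\<omega>. g (X \<omega>, h (W \<omega>)) \<partial>M)
      = (\<integral>\<^sup>+z. g (fst z, h (snd z)) \<partial>distr M (N \<Otimes>\<^sub>M L) (\<lambda>\<omega>. (X \<omega>, W \<omega>)))"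
    by (simp add: nn_integral_distr)
  also have "\<dots> = (\<integral>\<^sup>+z. g (fst z, h (snd z)) \<partial>(distr M N X \<Otimes>\<^sub>M distr M L W))"
    using ind by (simp add: indep_var_distribution_eq)
  also have "\<dots> = (\<integral>\<^sup>+x. \<integral>\<^sup>+w. g (x, h w) \<partial>distr M L W \<partial>distr M N X)"
    by (subst D.nn_integral_fst[symmetric]) simp_all
  also have "\<dots> = (\<integral>\<^sup>+\<omega>. \<integral>\<^sup>+w. g (X \<omega>, h w) \<partial>distr M L W \<partial>M)"
    by (subst nn_integral_distr) simp_all
  also have "\<dots> = (\<integral>\<^sup>+\<omega>. (\<integral>\<^sup>+y. f y * g (X \<omega>, y) \<partial>lborel) \<partial>M)"
  proof (rule nn_integral_cong)
    fix \<omega> assume "\<omega> \<in> space M"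
    then have x[measurable]: "X \<omega> \<in> space N" by (rule measurable_space[OF X])
    have gx: "(\<lambda>y. g (X \<omega>, y)) \<in> borel_measurable lborel" by measurable
    have "(\<integral>\<^sup>+w. g (X \<omega>, h w) \<partial>distr M L W) = (\<integral>\<^sup>+\<omega>'. g (X \<omega>, h (W \<omega>')) \<partial>M)"
      by (rule nn_integral_distr) measurable
    also have "\<dots> = (\<integral>\<^sup>+y. f y * g (X \<omega>, y) \<partial>lborel)"
      by (rule distributed_nn_integral[OF Y gx, symmetric])
    finally show "(\<integral>\<^sup>+w. g (X \<omega>, h w) \<partial>distr M L W) = (\<integral>\<^sup>+y. f y * g (X \<omega>, y) \<partial>lborel)" .
  qed
  finally show ?thesis .
qed

section \<open>Exponential tails of the step\<close>

lemma nn_integral_exp_tail: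
  fixes r c :: real
  assumes "r > 0"
  shows "(\<integral>\<^sup>+x. ennreal (exp (- r * x)) * indicator {c..} x \<partial>lborel) = ennreal (exp (- r * c) / r)"
proof -
  have "(\<integral>\<^sup>+x. ennreal (exp (- r * x)) * indicator {c..} x \<partial>lborel)
      = ennreal (0 - (- exp (- r * c) / r))"
  proof (rule nn_integral_FTC_atLeast)
    show "((\<lambda>x. - exp (- r * x) / r) has_real_derivative exp (- r * x)) (at x)" for x
      using assms by (auto intro!: derivative_eq_intros)
    show "((\<lambda>x. - exp (- r * x) / r) \<longlongrightarrow> 0) at_top"
      using assms by real_asymp
  qed auto
  then show ?thesis by simp
qed

lemma step_density_measurable [measurable]: "step_density p \<theta>1 \<theta>2 \<in> borel_measurable borel"
  unfolding step_density_def by measurable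

text \<open>The threshold \<open>c\<close> enters through a factor \<open>exp (- \<theta>1 * c)\<close> that does not depend on \<open>l\<close> and a factor
\<open>exp (l * c)\<close>: above \<open>c\<close> the density is that of \<open>c\<close> plus a fresh exponential variable. This is the
memoryless property behind the law of the overshoot.\<close>

lemma nn_integral_step_upper:
  assumes "p \<ge> 0" "\<theta>1 > 0" "l < \<theta>1" "c \<ge> 0"
  shows "(\<integral>\<^sup>+z. ennreal (step_density p \<theta>1 \<theta>2 z) * (ennreal (exp (l * z)) * indicator {c..} z) \<partial>lborel)
       = ennreal (p * (\<theta>1 / (\<theta>1 - l)) * exp (- (\<theta>1 - l) * c))"
proof -
  have "(\<integral>\<^sup>+z. ennreal (step_density p \<theta>1 \<theta>2 z) * (ennreal (exp (l * z)) * indicator {c..} z) \<partial>lborel)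
      = (\<integral>\<^sup>+z. ennreal (p * \<theta>1) * (ennreal (exp (- (\<theta>1 - l) * z)) * indicator {c..} z) \<partial>lborel)"
    using assms
    by (intro nn_integral_cong)
       (auto simp: step_density_def indicator_def ennreal_mult'[symmetric] exp_add[symmetric] algebra_simps)
  also have "\<dots> = ennreal (p * \<theta>1) * ennreal (exp (- (\<theta>1 - l) * c) / (\<theta>1 - l))"
    using assms nn_integral_exp_tail[of "\<theta>1 - l" c] by (subst nn_integral_cmult) simp_all
  also have "\<dots> = ennreal (p * (\<theta>1 / (\<theta>1 - l)) * exp (- (\<theta>1 - l) * c))"
    using assms by (simp add: ennreal_mult'[symmetric])
  finally show ?thesis .
qed

text \<open>Reflection at the origin exchanges the two rates and \<open>p\<close> with \<open>1 - p\<close>, and reduces this to the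
upper tail.\<close>

lemma nn_integral_step_lower:
  assumes "p \<le> 1" "\<theta>2 > 0" "- \<theta>2 < l" "c \<le> 0"
  shows "(\<integral>\<^sup>+z. ennreal (step_density p \<theta>1 \<theta>2 z) * (ennreal (exp (l * z)) * indicator {..c} z) \<partial>lborel)
       = ennreal ((1 - p) * (\<theta>2 / (\<theta>2 + l)) * exp ((\<theta>2 + l) * c))"
proof -
  have "(\<integral>\<^sup>+z. ennreal (step_density p \<theta>1 \<theta>2 z) * (ennreal (exp (l * z)) * indicator {..c} z) \<partial>lborel)
      = (\<integral>\<^sup>+z. ennreal (step_density p \<theta>1 \<theta>2 (- z)) * (ennreal (exp (l * - z)) * indicator {..c} (- z)) \<partial>lborel)"
    by (subst nn_integral_real_affine[where c = "-1" and t = 0]) simp_all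
  also have "\<dots> = (\<integral>\<^sup>+z. ennreal (step_density (1 - p) \<theta>2 \<theta>1 z) * (ennreal (exp (- l * z)) * indicator {- c..} z) \<partial>lborel)"
  proof (rule nn_integral_cong_AE)
    \<comment> \<open>At the origin the two densities take the values from different sides.\<close>
    show "AE z in lborel. ennreal (step_density p \<theta>1 \<theta>2 (- z)) * (ennreal (exp (l * - z)) * indicator {..c} (- z))
        = ennreal (step_density (1 - p) \<theta>2 \<theta>1 z) * (ennreal (exp (- l * z)) * indicator {- c..} z)"
      using AE_lborel_singleton[of "0::real"]
      by eventually_elim (auto simp: step_density_def indicator_def)
  qed
  also have "\<dots> = ennreal ((1 - p) * (\<theta>2 / (\<theta>2 + l)) * exp ((\<theta>2 + l) * c))"
    using assms by (subst nn_integral_step_upper) (simp_all add: algebra_simps)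
  finally show ?thesis .
qed

definition step_mgf :: "real \<Rightarrow> real \<Rightarrow> real \<Rightarrow> real \<Rightarrow> real" where
  "step_mgf p \<theta>1 \<theta>2 l = p * (\<theta>1 / (\<theta>1 - l)) + (1 - p) * (\<theta>2 / (\<theta>2 + l))"

lemma nn_integral_step_mgf:
  assumes "0 \<le> p" "p \<le> 1" "\<theta>1 > 0" "\<theta>2 > 0" "- \<theta>2 < l" "l < \<theta>1"
  shows "(\<integral>\<^sup>+z. ennreal (step_density p \<theta>1 \<theta>2 z) * ennreal (exp (l * z)) \<partial>lborel)
       = ennreal (step_mgf p \<theta>1 \<theta>2 l)"
proof -
  let ?f = "\<lambda>A z. ennreal (step_density p \<theta>1 \<theta>2 z) * (ennreal (exp (l * z)) * indicator A z)"
  have "(\<integral>\<^sup>+z. ennreal (step_density p \<theta>1 \<theta>2 z) * ennreal (exp (l * z)) \<partial>lborel)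
      = (\<integral>\<^sup>+z. ?f {0..} z + ?f {..0} z \<partial>lborel)"
    by (rule nn_integral_cong_AE, use AE_lborel_singleton[of "0::real"] in eventually_elim)
       (auto simp: indicator_def)
  also have "\<dots> = (\<integral>\<^sup>+z. ?f {0..} z \<partial>lborel) + (\<integral>\<^sup>+z. ?f {..0} z \<partial>lborel)"
    by (rule nn_integral_add) measurable
  also have "\<dots> = ennreal (step_mgf p \<theta>1 \<theta>2 l)"
    using assms by (simp add: nn_integral_step_upper nn_integral_step_lower step_mgf_def)
  finally show ?thesis .
qed

section \<open>The walk before and at its exit\<close>

locale double_exponential_walk = prob_space M for M :: "'a measure" +
  fixes Z :: "nat \<Rightarrow> 'a \<Rightarrow> real" and p \<theta>1 \<theta>2 a b :: real
  assumes p: "0 < p" "p < 1" and \<theta>: "\<theta>1 > 0" "\<theta>2 > 0" and ab: "a > 0" "b > 0"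
    and indep: "indep_vars (\<lambda>_. borel) Z {1..}"
    and step: "\<And>i. i \<ge> 1 \<Longrightarrow> distributed M lborel (Z i) (\<lambda>x. ennreal (step_density p \<theta>1 \<theta>2 x))"
begin

abbreviation S :: "nat \<Rightarrow> 'a \<Rightarrow> real" where "S \<equiv> walk Z"

text \<open>The event that the exit time exceeds \<open>n\<close>. The bound at \<open>m = 0\<close> always holds, since the walk starts at
\<open>0\<close> and the interval contains \<open>0\<close>.\<close>

definition alive :: "nat \<Rightarrow> 'a set" where
  "alive n = {\<omega> \<in> space M. \<forall>m\<le>n. - a < S m \<omega> \<and> S m \<omega> < b}"

text \<open>Exit through the top at time \<open>Suc n\<close>; the index is the last time before the exit.\<close>

definition up :: "nat \<Rightarrow> 'a set" where
  "up n = {\<omega> \<in> alive n. b \<le> S (Suc n) \<omega>}"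

definition down :: "nat \<Rightarrow> 'a set" where
  "down n = {\<omega> \<in> alive n. S (Suc n) \<omega> \<le> - a}"

lemma Z_measurable [measurable]: "Z (Suc i) \<in> borel_measurable M"
  using distributed_measurable[OF step[of "Suc i"]] by simp

lemma walk_0 [simp]: "S 0 \<omega> = 0" by (simp add: walk_def)

lemma walk_Suc: "S (Suc n) \<omega> = S n \<omega> + Z (Suc n) \<omega>" by (simp add: walk_def)

lemma walk_measurable [measurable]: "S n \<in> borel_measurable M"
proof (induction n)
  case 0
  then show ?case by (simp add: walk_def[abs_def])
next
  case (Suc n)
  then show ?case by (simp add: walk_Suc[abs_def])
qed

lemma alive_sets [measurable]: "alive n \<in> sets M" unfolding alive_def by measurable
lemma up_sets [measurable]: "up n \<in> sets M" unfolding up_def alive_def by measurable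
lemma down_sets [measurable]: "down n \<in> sets M" unfolding down_def alive_def by measurable

lemma alive_bounds: "\<omega> \<in> alive n \<Longrightarrow> - a < S n \<omega> \<and> S n \<omega> < b" by (auto simp: alive_def)

lemma alive_0: "alive 0 = space M" using ab by (auto simp: alive_def)

lemma alive_antimono: "n \<le> m \<Longrightarrow> alive m \<subseteq> alive n"
  by (force simp: alive_def)

lemma alive_split:
  "alive n = alive (Suc n) \<union> up n \<union> down n"
  "alive (Suc n) \<inter> up n = {}" "alive (Suc n) \<inter> down n = {}" "up n \<inter> down n = {}"
  using ab by (auto simp: alive_def up_def down_def le_Suc_eq)

text \<open>The Markov property: the event \<open>alive n\<close> and the position \<open>S n\<close> are functions of the first \<open>n\<close> steps,
so the next step may be integrated out against its density.\<close>

lemma nn_integral_next_step: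
  assumes F[measurable]: "case_prod F \<in> borel_measurable (borel \<Otimes>\<^sub>M borel)"
  shows "(\<integral>\<^sup>+\<omega>. F (S n \<omega>) (Z (Suc n) \<omega>) * indicator (alive n) \<omega> \<partial>M)
    = (\<integral>\<^sup>+\<omega>. (\<integral>\<^sup>+z. ennreal (step_density p \<theta>1 \<theta>2 z) * F (S n \<omega>) z \<partial>lborel) * indicator (alive n) \<omega> \<partial>M)"
proof -
  let ?N = "PiM {Suc 0..n} (\<lambda>_. borel :: real measure)"
  let ?L = "PiM {Suc n} (\<lambda>_. borel :: real measure)"
  let ?X = "\<lambda>\<omega>. restrict (\<lambda>i. Z i \<omega>) {Suc 0..n}"
  let ?W = "\<lambda>\<omega>. restrict (\<lambda>i. Z i \<omega>) {Suc n}"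
  \<comment> \<open>The walk and its survival event as functions of the family of the first \<open>n\<close> steps.\<close>
  define s :: "nat \<Rightarrow> (nat \<Rightarrow> real) \<Rightarrow> real" where "s m x = (\<Sum>i=Suc 0..m. x i)" for m x
  define G where "G = {x \<in> space ?N. \<forall>m\<le>n. - a < s m x \<and> s m x < b}"
  have sm[measurable]: "s m \<in> borel_measurable ?N" if "m \<le> n" for m
    unfolding s_def using that by (intro borel_measurable_sum measurable_component_singleton) auto
  have [measurable]: "G \<in> sets ?N"
  proof -
    have "G = (\<Inter>m\<in>{..n}. {x \<in> space ?N. - a < s m x \<and> s m x < b})"
      by (auto simp: G_def)
    also have "\<dots> \<in> sets ?N"
    proof (rule sets.finite_INT)
      show "{x \<in> space ?N. - a < s m x \<and> s m x < b} \<in> sets ?N" if "m \<in> {..n}" for m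
      proof -
        have [measurable]: "s m \<in> borel_measurable ?N" using sm[of m] that by simp
        show ?thesis by measurable
      qed
    qed auto
    finally show ?thesis .
  qed
  have sX: "s m (?X \<omega>) = S m \<omega>" if "m \<le> n" for m \<omega>
    using that by (auto simp: s_def walk_def intro!: sum.cong)
  have GX: "?X \<omega> \<in> G \<longleftrightarrow> \<omega> \<in> alive n" if "\<omega> \<in> space M" for \<omega>
    using that by (auto simp: G_def alive_def sX space_PiM)
  have ind: "indep_var ?N ?X ?L ?W"
    by (rule indep_var_restrict[OF indep]) auto
  have Y: "distributed M lborel (\<lambda>\<omega>. ?W \<omega> (Suc n)) (\<lambda>x. ennreal (step_density p \<theta>1 \<theta>2 x))"
    using step[of "Suc n"] by simp
  have h: "(\<lambda>w. w (Suc n)) \<in> borel_measurable ?L"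
    by (rule measurable_component_singleton) simp
  have [measurable]: "s n \<in> borel_measurable ?N" by (rule sm) simp
  define g where "g = (\<lambda>(x, z). F (s n x) z * indicator G x)"
  have g: "g \<in> borel_measurable (?N \<Otimes>\<^sub>M borel)" unfolding g_def by measurable
  have gX: "g (?X \<omega>, z) = F (S n \<omega>) z * indicator (alive n) \<omega>" if "\<omega> \<in> space M" for \<omega> z
    unfolding g_def using GX[OF that] sX[of n \<omega>] by (simp add: indicator_def)
  have "(\<integral>\<^sup>+\<omega>. F (S n \<omega>) (Z (Suc n) \<omega>) * indicator (alive n) \<omega> \<partial>M)
      = (\<integral>\<^sup>+\<omega>. g (?X \<omega>, ?W \<omega> (Suc n)) \<partial>M)"
    by (rule nn_integral_cong) (simp only: gX, simp)
  also have "\<dots> = (\<integral>\<^sup>+\<omega>. (\<integral>\<^sup>+z. ennreal (step_density p \<theta>1 \<theta>2 z) * g (?X \<omega>, z) \<partial>lborel) \<partial>M)"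
    by (rule nn_integral_indep_density[OF ind h Y g])
  also have "\<dots> = (\<integral>\<^sup>+\<omega>. (\<integral>\<^sup>+z. ennreal (step_density p \<theta>1 \<theta>2 z) * F (S n \<omega>) z \<partial>lborel) * indicator (alive n) \<omega> \<partial>M)"
    by (rule nn_integral_cong) (simp only: gX, simp split: split_indicator)
  finally show ?thesis .
qed

text \<open>The overshoot over \<open>b\<close> is exponential with rate \<open>\<theta>1\<close> whatever the position before the exit, and
\<open>\<theta>1 / (\<theta>1 - l)\<close> is its moment generating function. From the position \<open>s < b\<close> the exit has
probability \<open>p * exp (- \<theta>1 * (b - s))\<close>; the average of this over \<open>alive n\<close> does not depend on \<open>l\<close>, and
the case \<open>l = 0\<close> identifies it with the probability of \<open>up n\<close>.\<close>

lemma upper_exit_moment: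
  assumes l: "l < \<theta>1"
  shows "(\<integral>\<^sup>+\<omega>. ennreal (exp (l * S (Suc n) \<omega>)) * indicator (up n) \<omega> \<partial>M)
    = ennreal (\<theta>1 / (\<theta>1 - l) * exp (l * b)) * emeasure M (up n)"
proof -
  define Q where "Q = (\<integral>\<^sup>+\<omega>. ennreal (p * exp (- \<theta>1 * (b - S n \<omega>))) * indicator (alive n) \<omega> \<partial>M)"
  have *: "(\<integral>\<^sup>+\<omega>. ennreal (exp (l * S (Suc n) \<omega>)) * indicator (up n) \<omega> \<partial>M)
    = ennreal (\<theta>1 / (\<theta>1 - l) * exp (l * b)) * Q" if l: "l < \<theta>1" for l
  proof -
    have inner: "(\<integral>\<^sup>+z. ennreal (step_density p \<theta>1 \<theta>2 z) * (ennreal (exp (l * (s + z))) * indicator {b..} (s + z)) \<partial>lborel)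
        = ennreal (\<theta>1 / (\<theta>1 - l) * exp (l * b)) * ennreal (p * exp (- \<theta>1 * (b - s)))" if s: "s < b" for s
    proof -
      have "(\<integral>\<^sup>+z. ennreal (step_density p \<theta>1 \<theta>2 z) * (ennreal (exp (l * (s + z))) * indicator {b..} (s + z)) \<partial>lborel)
        = (\<integral>\<^sup>+z. ennreal (exp (l * s)) * (ennreal (step_density p \<theta>1 \<theta>2 z) * (ennreal (exp (l * z)) * indicator {b - s..} z)) \<partial>lborel)"
        by (intro nn_integral_cong)
           (auto simp: indicator_def exp_add distrib_left ennreal_mult' mult_ac)
      also have "\<dots> = ennreal (exp (l * s)) * ennreal (p * (\<theta>1 / (\<theta>1 - l)) * exp (- (\<theta>1 - l) * (b - s)))"
        using p \<theta> l s nn_integral_step_upper[of p \<theta>1 l "b - s" \<theta>2] by (subst nn_integral_cmult) simp_all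
      also have "\<dots> = ennreal (\<theta>1 / (\<theta>1 - l) * exp (l * b)) * ennreal (p * exp (- \<theta>1 * (b - s)))"
        using p \<theta> l by (simp add: ennreal_mult'[symmetric] exp_add[symmetric] mult_ac) (simp add: algebra_simps)
      finally show ?thesis .
    qed
    have "(\<integral>\<^sup>+\<omega>. ennreal (exp (l * S (Suc n) \<omega>)) * indicator (up n) \<omega> \<partial>M)
      = (\<integral>\<^sup>+\<omega>. (ennreal (exp (l * (S n \<omega> + Z (Suc n) \<omega>))) * indicator {b..} (S n \<omega> + Z (Suc n) \<omega>)) * indicator (alive n) \<omega> \<partial>M)"
      by (intro nn_integral_cong) (auto simp: up_def walk_Suc indicator_def)
    also have "\<dots> = (\<integral>\<^sup>+\<omega>. ennreal (\<theta>1 / (\<theta>1 - l) * exp (l * b))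
        * (ennreal (p * exp (- \<theta>1 * (b - S n \<omega>))) * indicator (alive n) \<omega>) \<partial>M)"
      by (subst nn_integral_next_step, measurable, intro nn_integral_cong)
         (auto simp: inner alive_bounds split: split_indicator)
    also have "\<dots> = ennreal (\<theta>1 / (\<theta>1 - l) * exp (l * b)) * Q"
      unfolding Q_def by (rule nn_integral_cmult) measurable
    finally show ?thesis .
  qed
  have "emeasure M (up n) = Q"
    using *[of 0] \<theta> by simp
  then show ?thesis using *[OF l] by simp
qed

text \<open>The overshoot below \<open>- a\<close> is exponential with rate \<open>\<theta>2\<close>, by the same argument.\<close>

lemma lower_exit_moment:
  assumes l: "- \<theta>2 < l"
  shows "(\<integral>\<^sup>+\<omega>. ennreal (exp (l * S (Suc n) \<omega>)) * indicator (down n) \<omega> \<partial>M)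
    = ennreal (\<theta>2 / (\<theta>2 + l) * exp (- l * a)) * emeasure M (down n)"
proof -
  define Q where "Q = (\<integral>\<^sup>+\<omega>. ennreal ((1 - p) * exp (- \<theta>2 * (S n \<omega> + a))) * indicator (alive n) \<omega> \<partial>M)"
  have *: "(\<integral>\<^sup>+\<omega>. ennreal (exp (l * S (Suc n) \<omega>)) * indicator (down n) \<omega> \<partial>M)
    = ennreal (\<theta>2 / (\<theta>2 + l) * exp (- l * a)) * Q" if l: "- \<theta>2 < l" for l
  proof -
    have inner: "(\<integral>\<^sup>+z. ennreal (step_density p \<theta>1 \<theta>2 z) * (ennreal (exp (l * (s + z))) * indicator {..- a} (s + z)) \<partial>lborel)
        = ennreal (\<theta>2 / (\<theta>2 + l) * exp (- l * a)) * ennreal ((1 - p) * exp (- \<theta>2 * (s + a)))" if s: "- a < s" for s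
    proof -
      have "(\<integral>\<^sup>+z. ennreal (step_density p \<theta>1 \<theta>2 z) * (ennreal (exp (l * (s + z))) * indicator {..- a} (s + z)) \<partial>lborel)
        = (\<integral>\<^sup>+z. ennreal (exp (l * s)) * (ennreal (step_density p \<theta>1 \<theta>2 z) * (ennreal (exp (l * z)) * indicator {..- a - s} z)) \<partial>lborel)"
        by (intro nn_integral_cong)
           (auto simp: indicator_def exp_add distrib_left ennreal_mult' mult_ac)
      also have "\<dots> = ennreal (exp (l * s)) * ennreal ((1 - p) * (\<theta>2 / (\<theta>2 + l)) * exp ((\<theta>2 + l) * (- a - s)))"
        using p \<theta> l s nn_integral_step_lower[of p \<theta>2 l "- a - s" \<theta>1] by (subst nn_integral_cmult) simp_all
      also have "\<dots> = ennreal (\<theta>2 / (\<theta>2 + l) * exp (- l * a)) * ennreal ((1 - p) * exp (- \<theta>2 * (s + a)))"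
        using p \<theta> l by (simp add: ennreal_mult'[symmetric] exp_add[symmetric] mult_ac) (simp add: algebra_simps)
      finally show ?thesis .
    qed
    have "(\<integral>\<^sup>+\<omega>. ennreal (exp (l * S (Suc n) \<omega>)) * indicator (down n) \<omega> \<partial>M)
      = (\<integral>\<^sup>+\<omega>. (ennreal (exp (l * (S n \<omega> + Z (Suc n) \<omega>))) * indicator {..- a} (S n \<omega> + Z (Suc n) \<omega>)) * indicator (alive n) \<omega> \<partial>M)"
      by (intro nn_integral_cong) (auto simp: down_def walk_Suc indicator_def)
    also have "\<dots> = (\<integral>\<^sup>+\<omega>. ennreal (\<theta>2 / (\<theta>2 + l) * exp (- l * a))
        * (ennreal ((1 - p) * exp (- \<theta>2 * (S n \<omega> + a))) * indicator (alive n) \<omega>) \<partial>M)"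
      by (subst nn_integral_next_step, measurable, intro nn_integral_cong)
         (auto simp: inner alive_bounds split: split_indicator)
    also have "\<dots> = ennreal (\<theta>2 / (\<theta>2 + l) * exp (- l * a)) * Q"
      unfolding Q_def by (rule nn_integral_cmult) measurable
    finally show ?thesis .
  qed
  have "emeasure M (down n) = Q"
    using *[of 0] \<theta> by simp
  then show ?thesis using *[OF l] by simp
qed

text \<open>The expectation of \<open>exp (l * S n)\<close> on survival up to \<open>n\<close>. It is finite, because \<open>S n\<close> is confined to the
interval there; \<open>alive_moment_eq\<close> records this.\<close>

definition alive_moment :: "real \<Rightarrow> nat \<Rightarrow> real" where
  "alive_moment l n = enn2real (\<integral>\<^sup>+\<omega>. ennreal (exp (l * S n \<omega>)) * indicator (alive n) \<omega> \<partial>M)"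

lemma alive_moment_le:
  "(\<integral>\<^sup>+\<omega>. ennreal (exp (l * S n \<omega>)) * indicator (alive n) \<omega> \<partial>M) \<le> ennreal (exp (\<bar>l\<bar> * (a + b)))"
proof -
  have "(\<integral>\<^sup>+\<omega>. ennreal (exp (l * S n \<omega>)) * indicator (alive n) \<omega> \<partial>M)
      \<le> (\<integral>\<^sup>+\<omega>. ennreal (exp (\<bar>l\<bar> * (a + b))) \<partial>M)"
  proof (rule nn_integral_mono)
    fix \<omega>
    have "l * S n \<omega> \<le> \<bar>l\<bar> * (a + b)" if "\<omega> \<in> alive n"
    proof -
      have "l * S n \<omega> \<le> \<bar>l\<bar> * \<bar>S n \<omega>\<bar>" by (metis abs_ge_self abs_mult)
      also have "\<dots> \<le> \<bar>l\<bar> * (a + b)"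
        using alive_bounds[OF that] ab by (intro mult_left_mono) auto
      finally show ?thesis .
    qed
    then show "ennreal (exp (l * S n \<omega>)) * indicator (alive n) \<omega> \<le> ennreal (exp (\<bar>l\<bar> * (a + b)))"
      by (auto simp: indicator_def intro!: ennreal_leI)
  qed
  then show ?thesis by (simp add: emeasure_space_1)
qed

lemma alive_moment_eq:
  "(\<integral>\<^sup>+\<omega>. ennreal (exp (l * S n \<omega>)) * indicator (alive n) \<omega> \<partial>M) = ennreal (alive_moment l n)"
  unfolding alive_moment_def using alive_moment_le[of l n]
  by (intro ennreal_enn2real[symmetric]) (auto intro: le_less_trans)

lemma alive_moment_bounds: "0 \<le> alive_moment l n" "alive_moment l n \<le> exp (\<bar>l\<bar> * (a + b))"
proof -
  show nonneg: "0 \<le> alive_moment l n" by (simp add: alive_moment_def)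
  show "alive_moment l n \<le> exp (\<bar>l\<bar> * (a + b))"
    using alive_moment_le[of l n] by (simp add: alive_moment_eq)
qed

lemma alive_moment_0: "alive_moment l 0 = 1"
  by (simp add: alive_moment_def alive_0 emeasure_space_1)

text \<open>Both sides compute the expectation of \<open>exp (l * S (Suc n))\<close> on \<open>alive n\<close>: the left one by integrating
out the last step, the right one by splitting according to where the walk then is. On the
right the overshoot laws replace the exponential moments by plain probabilities.\<close>

lemma alive_moment_recursion:
  assumes l: "- \<theta>2 < l" "l < \<theta>1"
  shows "step_mgf p \<theta>1 \<theta>2 l * alive_moment l n = alive_moment l (Suc n)
    + \<theta>1 / (\<theta>1 - l) * exp (l * b) * prob (up n) + \<theta>2 / (\<theta>2 + l) * exp (- l * a) * prob (down n)"
    (is "_ = ?R")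
proof -
  have mgf: "0 \<le> step_mgf p \<theta>1 \<theta>2 l"
    unfolding step_mgf_def using p \<theta> l by (intro add_nonneg_nonneg mult_nonneg_nonneg divide_nonneg_pos) auto
  let ?E = "\<lambda>\<omega>. ennreal (exp (l * S (Suc n) \<omega>))"
  have inner: "(\<integral>\<^sup>+z. ennreal (step_density p \<theta>1 \<theta>2 z) * ennreal (exp (l * (s + z))) \<partial>lborel)
      = ennreal (step_mgf p \<theta>1 \<theta>2 l) * ennreal (exp (l * s))" for s
  proof -
    have "(\<integral>\<^sup>+z. ennreal (step_density p \<theta>1 \<theta>2 z) * ennreal (exp (l * (s + z))) \<partial>lborel)
      = (\<integral>\<^sup>+z. ennreal (exp (l * s)) * (ennreal (step_density p \<theta>1 \<theta>2 z) * ennreal (exp (l * z))) \<partial>lborel)"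
      by (intro nn_integral_cong) (auto simp: exp_add distrib_left ennreal_mult' mult_ac)
    also have "\<dots> = ennreal (step_mgf p \<theta>1 \<theta>2 l) * ennreal (exp (l * s))"
      using p \<theta> l by (simp add: nn_integral_cmult nn_integral_step_mgf) (simp add: mult.commute)
    finally show ?thesis .
  qed
  have "(\<integral>\<^sup>+\<omega>. ?E \<omega> * indicator (alive n) \<omega> \<partial>M)
      = (\<integral>\<^sup>+\<omega>. ennreal (exp (l * (S n \<omega> + Z (Suc n) \<omega>))) * indicator (alive n) \<omega> \<partial>M)"
    by (simp add: walk_Suc)
  also have "\<dots> = (\<integral>\<^sup>+\<omega>. ennreal (step_mgf p \<theta>1 \<theta>2 l) * (ennreal (exp (l * S n \<omega>)) * indicator (alive n) \<omega>) \<partial>M)"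
    by (subst nn_integral_next_step, measurable) (simp add: inner mult_ac)
  also have "\<dots> = ennreal (step_mgf p \<theta>1 \<theta>2 l) * ennreal (alive_moment l n)"
    by (subst nn_integral_cmult) (simp_all add: alive_moment_eq)
  finally have 1: "(\<integral>\<^sup>+\<omega>. ?E \<omega> * indicator (alive n) \<omega> \<partial>M)
      = ennreal (step_mgf p \<theta>1 \<theta>2 l * alive_moment l n)"
    using mgf by (simp add: ennreal_mult')
  have "(\<integral>\<^sup>+\<omega>. ?E \<omega> * indicator (alive n) \<omega> \<partial>M)
      = (\<integral>\<^sup>+\<omega>. ?E \<omega> * indicator (alive (Suc n)) \<omega> + ?E \<omega> * indicator (up n) \<omega> + ?E \<omega> * indicator (down n) \<omega> \<partial>M)"
    using alive_split[of n] by (intro nn_integral_cong) (auto simp: indicator_def)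
  also have "\<dots> = (\<integral>\<^sup>+\<omega>. ?E \<omega> * indicator (alive (Suc n)) \<omega> \<partial>M)
      + (\<integral>\<^sup>+\<omega>. ?E \<omega> * indicator (up n) \<omega> \<partial>M) + (\<integral>\<^sup>+\<omega>. ?E \<omega> * indicator (down n) \<omega> \<partial>M)"
    by (simp add: nn_integral_add)
  also have "\<dots> = ennreal ?R"
    using \<theta> l alive_moment_bounds(1)[of l "Suc n"]
    by (simp add: alive_moment_eq upper_exit_moment lower_exit_moment emeasure_eq_measure
        ennreal_mult'[symmetric] ennreal_plus[symmetric] del: ennreal_plus)
  finally have "ennreal (step_mgf p \<theta>1 \<theta>2 l * alive_moment l n) = ennreal ?R"
    using 1 by simp
  then show ?thesis
    using \<theta> l mgf alive_moment_bounds(1)[of l "Suc n"] alive_moment_bounds(1)[of l n]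
    by (subst (asm) ennreal_inj) (auto intro!: add_nonneg_nonneg mult_nonneg_nonneg)
qed


lemma exit_time_eq:
  assumes "\<omega> \<in> alive n" "\<omega> \<notin> alive (Suc n)"
  shows "exit_time Z a b \<omega> = enat (Suc n)"
  unfolding exit_time_def
proof (rule antisym)
  show "Inf {enat k |k. 1 \<le> k \<and> (b \<le> S k \<omega> \<or> S k \<omega> \<le> - a)} \<le> enat (Suc n)"
    using assms by (intro Inf_lower) (auto simp: alive_def le_Suc_eq)
  show "enat (Suc n) \<le> Inf {enat k |k. 1 \<le> k \<and> (b \<le> S k \<omega> \<or> S k \<omega> \<le> - a)}"
  proof (rule Inf_greatest)
    fix x assume "x \<in> {enat k |k. 1 \<le> k \<and> (b \<le> S k \<omega> \<or> S k \<omega> \<le> - a)}"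
    then obtain k where "x = enat k" "b \<le> S k \<omega> \<or> S k \<omega> \<le> - a" by auto
    moreover from this have "\<not> k \<le> n" using assms(1) by (auto simp: alive_def)
    ultimately show "enat (Suc n) \<le> x" by simp
  qed
qed

lemma exit_time_infinite:
  assumes "\<And>n. \<omega> \<in> alive n"
  shows "exit_time Z a b \<omega> = \<infinity>"
proof -
  have "{enat k |k. 1 \<le> k \<and> (b \<le> S k \<omega> \<or> S k \<omega> \<le> - a)} = {}"
    using alive_bounds[OF assms] by (auto simp: not_le)
  then show ?thesis unfolding exit_time_def by (simp only:) (simp add: Inf_enat_def)
qed

text \<open>The partial sums vanish until the walk exits and are constant from then on, so they are bounded by
\<open>1\<close> and converge pathwise to \<open>u ^ T\<close>, also on paths that never exit.\<close>

lemma partial_sum_eq: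
  assumes \<omega>: "\<omega> \<in> space M"
  shows "(\<Sum>n<N. u ^ Suc n * (indicator (up n) \<omega> + indicator (down n) \<omega>))
    = (if \<omega> \<in> alive N then 0 else power_enat u (exit_time Z a b \<omega>))"
proof (induction N)
  case 0
  then show ?case using \<omega> by (simp add: alive_0)
next
  case (Suc N)
  have T: "exit_time Z a b \<omega> = enat (Suc N)" if "\<omega> \<in> up N \<union> down N"
    using exit_time_eq[of \<omega> N] alive_split[of N] that by blast
  show ?case
    unfolding sum.lessThan_Suc Suc.IH
    using alive_split[of N] T by (auto simp: indicator_def power_enat_def)
qed

lemma expectation_exit_time:
  assumes u: "0 < u" "u < 1"
  shows "(\<lambda>n. u ^ Suc n * (prob (up n) + prob (down n))) sums
    expectation (\<lambda>\<omega>. power_enat u (exit_time Z a b \<omega>))"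
proof -
  define s where "s N \<omega> = (\<Sum>n<N. u ^ Suc n * (indicator (up n) \<omega> + indicator (down n) \<omega>))"
    for N and \<omega> :: 'a
  let ?T = "\<lambda>\<omega>. power_enat u (exit_time Z a b \<omega>)"
  have [measurable]: "s N \<in> borel_measurable M" for N unfolding s_def by measurable
  have s_eq: "s N \<omega> = (if \<omega> \<in> alive N then 0 else ?T \<omega>)" if "\<omega> \<in> space M" for N \<omega>
    unfolding s_def using that by (rule partial_sum_eq)
  have lim: "(\<lambda>N. s N \<omega>) \<longlonglongrightarrow> ?T \<omega>" if \<omega>: "\<omega> \<in> space M" for \<omega>
  proof (cases "\<forall>N. \<omega> \<in> alive N")
    case True
    then show ?thesis
      using \<omega> by (simp add: s_eq exit_time_infinite power_enat_def)
  next
    case False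
    then obtain N where N: "\<omega> \<notin> alive N" by auto
    have "s m \<omega> = ?T \<omega>" if "m \<ge> N" for m
    proof -
      have "\<omega> \<notin> alive m" using N alive_antimono[OF that] by blast
      then show ?thesis using \<omega> by (simp add: s_eq)
    qed
    then show ?thesis
      by (intro tendsto_eventually) (auto simp: eventually_sequentially)
  qed
  have [measurable]: "?T \<in> borel_measurable M"
    by (rule borel_measurable_LIMSEQ_real[where u = s]) (auto intro: lim)
  have T: "0 \<le> power_enat u t" "power_enat u t \<le> 1" for t
    using u by (auto simp: power_enat_def power_le_one split: enat.split)
  have "(\<lambda>N. expectation (s N)) \<longlonglongrightarrow> expectation ?T"
  proof (rule integral_dominated_convergence[where w = "\<lambda>_. 1"])
    show "AE \<omega> in M. norm (s N \<omega>) \<le> 1" for N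
      using T by (intro AE_I2) (simp add: s_eq)
  qed (auto intro: lim)
  moreover have "expectation (s N) = (\<Sum>n<N. u ^ Suc n * (prob (up n) + prob (down n)))" for N
  proof -
    have i: "integrable M (\<lambda>\<omega>. u ^ Suc n * (indicator (up n) \<omega> + indicator (down n) \<omega> :: real))" for n
      by (intro integrable_mult_right Bochner_Integration.integrable_add integrable_real_indicator)
         (auto simp: emeasure_eq_measure)
    have e: "expectation (\<lambda>\<omega>. u ^ Suc n * (indicator (up n) \<omega> + indicator (down n) \<omega>))
        = u ^ Suc n * (prob (up n) + prob (down n))" for n
      by (subst integral_mult_right_zero, subst Bochner_Integration.integral_add)
         (auto simp: emeasure_eq_measure)
    show ?thesis unfolding s_def by (simp only: Bochner_Integration.integral_sum i e)
  qed
  ultimately show ?thesis by (simp add: sums_def)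
qed

definition upper_gf :: "real \<Rightarrow> real" where "upper_gf u = (\<Sum>n. u ^ Suc n * prob (up n))"
definition lower_gf :: "real \<Rightarrow> real" where "lower_gf u = (\<Sum>n. u ^ Suc n * prob (down n))"

lemma gf_summable:
  assumes u: "0 < u" "u < 1"
  shows "summable (\<lambda>n. u ^ Suc n * prob (A n))"
proof (rule summable_comparison_test')
  show "summable (\<lambda>n. u ^ Suc n)" using u by (simp add: summable_geometric)
  show "norm (u ^ Suc n * prob (A n)) \<le> u ^ Suc n" for n
    using u mult_left_mono[OF prob_le_1[of "A n"], of "u ^ Suc n"] by (simp add: abs_mult)
qed

lemma expectation_eq_gf:
  assumes u: "0 < u" "u < 1"
  shows "expectation (\<lambda>\<omega>. power_enat u (exit_time Z a b \<omega>)) = upper_gf u + lower_gf u"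
  using sums_unique[OF expectation_exit_time[OF u]] suminf_add[OF gf_summable[OF u, of up] gf_summable[OF u, of down]]
  by (simp add: upper_gf_def lower_gf_def distrib_left)

text \<open>Optional stopping at the exit for the martingale \<open>u ^ n * exp (l * S n)\<close>. The recursion for
\<open>alive_moment\<close> telescopes because \<open>u\<close> cancels the moment generating function; what remains tends to
\<open>0\<close> since \<open>u < 1\<close> and the moments are bounded.\<close>

lemma exit_identity:
  assumes u: "0 < u" "u < 1" and l: "- \<theta>2 < l" "l < \<theta>1" and root: "u * step_mgf p \<theta>1 \<theta>2 l = 1"
  shows "\<theta>1 / (\<theta>1 - l) * exp (l * b) * upper_gf u + \<theta>2 / (\<theta>2 + l) * exp (- l * a) * lower_gf u = 1"
proof -
  let ?c = "\<theta>1 / (\<theta>1 - l) * exp (l * b)" and ?d = "\<theta>2 / (\<theta>2 + l) * exp (- l * a)"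
  let ?x = "\<lambda>n. ?c * (u ^ Suc n * prob (up n)) + ?d * (u ^ Suc n * prob (down n))"
  have telescope: "(\<Sum>n<N. ?x n) = 1 - u ^ N * alive_moment l N" for N
  proof (induction N)
    case 0
    then show ?case by (simp add: alive_moment_0)
  next
    case (Suc N)
    have "u ^ N * alive_moment l N = u ^ N * (u * step_mgf p \<theta>1 \<theta>2 l) * alive_moment l N"
      by (simp add: root)
    also have "\<dots> = u ^ Suc N * (step_mgf p \<theta>1 \<theta>2 l * alive_moment l N)"
      by (simp add: mult_ac)
    also have "\<dots> = u ^ Suc N * alive_moment l (Suc N) + ?x N"
      unfolding alive_moment_recursion[OF l] by (simp add: distrib_left mult_ac)
    finally show ?case using Suc.IH by simp
  qed
  have "(\<lambda>N. u ^ N * alive_moment l N) \<longlonglongrightarrow> 0"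
  proof (rule Lim_null_comparison)
    show "\<forall>\<^sub>F N in sequentially. norm (u ^ N * alive_moment l N) \<le> u ^ N * exp (\<bar>l\<bar> * (a + b))"
      using u alive_moment_bounds by (auto simp: abs_mult intro!: always_eventually mult_left_mono)
    show "(\<lambda>N. u ^ N * exp (\<bar>l\<bar> * (a + b))) \<longlonglongrightarrow> 0"
      using u by (intro tendsto_mult_left_zero LIMSEQ_realpow_zero) auto
  qed
  then have "(\<lambda>N. 1 - u ^ N * alive_moment l N) \<longlonglongrightarrow> 1 - 0"
    by (intro tendsto_diff tendsto_const)
  then have "?x sums 1" unfolding sums_def telescope by simp
  moreover have "?x sums (?c * upper_gf u + ?d * lower_gf u)"
    unfolding upper_gf_def lower_gf_def
    by (intro sums_add sums_mult summable_sums gf_summable u)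
  ultimately show ?thesis by (rule sums_unique2[symmetric])
qed

end

section \<open>The two roots\<close>

lemma step_mgf_root:
  assumes l: "- \<theta>2 < l" "l < \<theta>1"
    and q: "(\<theta>1 - l) * (\<theta>2 + l) = u * (p * \<theta>1 * (\<theta>2 + l) + (1 - p) * \<theta>2 * (\<theta>1 - l))"
  shows "u * step_mgf p \<theta>1 \<theta>2 l = 1"
proof -
  have "u * step_mgf p \<theta>1 \<theta>2 l
      = u * (p * \<theta>1 * (\<theta>2 + l) + (1 - p) * \<theta>2 * (\<theta>1 - l)) / ((\<theta>1 - l) * (\<theta>2 + l))"
    unfolding step_mgf_def using l by (simp add: field_simps)
  then show ?thesis using l unfolding q[symmetric] by simp
qed

text \<open>Clearing denominators, \<open>u * step_mgf p \<theta>1 \<theta>2 l = 1\<close> becomes a monic quadratic equation with sum of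
roots \<open>K\<close> and product \<open>- (1 - u) * \<theta>1 * \<theta>2\<close>. The product is negative, so the roots have opposite
signs. The values of the quadratic at \<open>\<theta>1\<close> and \<open>- \<theta>2\<close> are positive, which confines the roots to the
interval between; the same two values are the constants in the denominators of the final formula.\<close>

lemma roots:
  fixes p \<theta>1 \<theta>2 u :: real
  defines "\<beta> \<equiv> beta p \<theta>1 \<theta>2 u" and "w \<equiv> root_w p \<theta>1 \<theta>2 u"
  assumes p: "0 < p" "p < 1" and \<theta>: "\<theta>1 > 0" "\<theta>2 > 0" and u: "0 < u" "u < 1"
  shows "\<beta> < 0" and "0 < w" "w < \<theta>1" and "- \<theta>2 < w + \<beta>" "w + \<beta> < 0"
    and "(\<theta>1 - w) * (\<theta>1 - (w + \<beta>)) = u * p * \<theta>1 * (\<theta>1 + \<theta>2)"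
    and "(\<theta>2 + w) * (\<theta>2 + (w + \<beta>)) = u * (1 - p) * \<theta>2 * (\<theta>1 + \<theta>2)"
    and "u * step_mgf p \<theta>1 \<theta>2 w = 1" "u * step_mgf p \<theta>1 \<theta>2 (w + \<beta>) = 1"
proof -
  define K where "K = \<theta>1 - \<theta>2 + u * ((1 - p) * \<theta>2 - p * \<theta>1)"
  have c: "0 < (1 - u) * \<theta>1 * \<theta>2" using u \<theta> by simp
  then have D: "0 < K\<^sup>2 + 4 * ((1 - u) * \<theta>1 * \<theta>2)" by (intro add_nonneg_pos) auto
  have \<beta>: "\<beta> = - sqrt (K\<^sup>2 + 4 * ((1 - u) * \<theta>1 * \<theta>2))"
    by (simp add: \<beta>_def beta_def K_def mult.assoc)
  have \<beta>2: "\<beta>\<^sup>2 = K\<^sup>2 + 4 * ((1 - u) * \<theta>1 * \<theta>2)" using D by (simp add: \<beta>)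
  show \<beta>_neg: "\<beta> < 0" using D by (simp add: \<beta>)
  have w: "w = (K - \<beta>) / 2" by (simp add: w_def root_w_def K_def \<beta>_def)
  have sum: "w + (w + \<beta>) = K" by (simp add: w field_simps)
  have prod: "w * (w + \<beta>) = - ((1 - u) * \<theta>1 * \<theta>2)"
  proof -
    have "2 * w = K - \<beta>" using w by simp
    moreover from this have "2 * (w + \<beta>) = K + \<beta>" by (simp add: distrib_left)
    moreover have "4 * (w * (w + \<beta>)) = (2 * w) * (2 * (w + \<beta>))" by simp
    ultimately have "4 * (w * (w + \<beta>)) = (K - \<beta>) * (K + \<beta>)" by (simp only:)
    also have "\<dots> = K\<^sup>2 - \<beta>\<^sup>2" by (simp add: algebra_simps power2_eq_square)
    finally show ?thesis using \<beta>2 by simp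
  qed
  have "w * (w + \<beta>) < 0" using prod c by simp
  then show w0: "0 < w" and v0: "w + \<beta> < 0" using \<beta>_neg by (auto simp: mult_less_0_iff)
  \<comment> \<open>Vieta: the quadratic is the product of its linear factors.\<close>
  have factor: "(x - w) * (x - (w + \<beta>)) = x\<^sup>2 - K * x - (1 - u) * \<theta>1 * \<theta>2" for x
  proof -
    have "(x - w) * (x - (w + \<beta>)) = x\<^sup>2 - (w + (w + \<beta>)) * x + w * (w + \<beta>)"
      by (simp add: algebra_simps power2_eq_square)
    then show ?thesis by (simp only: sum prod)
  qed
  show V1: "(\<theta>1 - w) * (\<theta>1 - (w + \<beta>)) = u * p * \<theta>1 * (\<theta>1 + \<theta>2)"
    unfolding factor by (simp add: K_def algebra_simps power2_eq_square)
  have "(- \<theta>2 - w) * (- \<theta>2 - (w + \<beta>)) = u * (1 - p) * \<theta>2 * (\<theta>1 + \<theta>2)"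
    unfolding factor by (simp add: K_def algebra_simps power2_eq_square)
  moreover have "(\<theta>2 + w) * (\<theta>2 + (w + \<beta>)) = (- \<theta>2 - w) * (- \<theta>2 - (w + \<beta>))"
    by (simp add: algebra_simps)
  ultimately show V2: "(\<theta>2 + w) * (\<theta>2 + (w + \<beta>)) = u * (1 - p) * \<theta>2 * (\<theta>1 + \<theta>2)" by simp
  have "0 < (\<theta>1 - w) * (\<theta>1 - (w + \<beta>))" unfolding V1 using u p \<theta> by simp
  then show w1: "w < \<theta>1" using v0 \<theta> by (auto simp: zero_less_mult_iff)
  have "0 < (\<theta>2 + w) * (\<theta>2 + (w + \<beta>))" unfolding V2 using u p \<theta> by simp
  then show v1: "- \<theta>2 < w + \<beta>" using w0 \<theta> by (auto simp: zero_less_mult_iff)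
  have mgf: "u * step_mgf p \<theta>1 \<theta>2 x = 1" if x: "- \<theta>2 < x" "x < \<theta>1" and "(x - w) * (x - (w + \<beta>)) = 0" for x
  proof (rule step_mgf_root[OF x])
    have "x\<^sup>2 - K * x - (1 - u) * \<theta>1 * \<theta>2 = 0" using that factor by simp
    then show "(\<theta>1 - x) * (\<theta>2 + x) = u * (p * \<theta>1 * (\<theta>2 + x) + (1 - p) * \<theta>2 * (\<theta>1 - x))"
      by (simp add: K_def algebra_simps power2_eq_square)
  qed
  show "u * step_mgf p \<theta>1 \<theta>2 w = 1" by (rule mgf) (use w0 w1 \<theta> in auto)
  show "u * step_mgf p \<theta>1 \<theta>2 (w + \<beta>) = 1" by (rule mgf) (use v0 v1 \<theta> in auto)
qed

theorem proposition4:
  fixes M :: "'a measure" and Z :: "nat \<Rightarrow> 'a \<Rightarrow> real"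
    and p \<theta>1 \<theta>2 a b u \<beta> w :: real
  assumes "prob_space M"
    and "0 < p" "p < 1" and "\<theta>1 > 0" "\<theta>2 > 0" and "a > 0" "b > 0"
    and "prob_space.indep_vars M (\<lambda>_. borel) Z {1..}"
    and "\<And>i. i \<ge> 1 \<Longrightarrow> distributed M lborel (Z i) (\<lambda>x. ennreal (step_density p \<theta>1 \<theta>2 x))"
    and "0 < u" "u < 1"
    and "\<beta> = beta p \<theta>1 \<theta>2 u" and "w = root_w p \<theta>1 \<theta>2 u"
  shows "prob_space.expectation M (\<lambda>\<omega>. power_enat u (exit_time Z a b \<omega>)) =
      ((\<theta>1 - w) / (\<theta>1 * exp (w * b)) - (\<theta>2 + w) * exp (w * a) / \<theta>2)
        * (1 - (\<theta>2 + w)\<^sup>2 * exp (- \<beta> * a) / (u * (1 - p) * \<theta>2 * (\<theta>1 + \<theta>2)))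
        / ((\<theta>1 - w)\<^sup>2 * exp (\<beta> * b) / (u * p * \<theta>1 * (\<theta>1 + \<theta>2))
            - (\<theta>2 + w)\<^sup>2 * exp (- \<beta> * a) / (u * (1 - p) * \<theta>2 * (\<theta>1 + \<theta>2)))
      + (\<theta>2 + w) * exp (w * a) / \<theta>2"
proof -
  interpret double_exponential_walk M Z p \<theta>1 \<theta>2 a b
    using assms by (auto simp: double_exponential_walk_def double_exponential_walk_axioms_def)
  note u = \<open>0 < u\<close> \<open>u < 1\<close>
  note r = roots[OF \<open>0 < p\<close> \<open>p < 1\<close> \<open>\<theta>1 > 0\<close> \<open>\<theta>2 > 0\<close> u,
      folded \<open>\<beta> = beta p \<theta>1 \<theta>2 u\<close> \<open>w = root_w p \<theta>1 \<theta>2 u\<close>]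
  define v where "v = w + \<beta>"
  have v: "- \<theta>2 < v" "v < 0" and wv: "v < w"
    using r by (auto simp: v_def)
  have pos: "0 < \<theta>1 - w" "0 < \<theta>2 + w" "0 < \<theta>1 - v" "0 < \<theta>2 + v"
    using r(2,3) v \<theta> by auto
  \<comment> \<open>The two terms of the exit identity at the root \<open>w\<close>. At the root \<open>v\<close> they become \<open>A * C\<close> and \<open>B * D\<close>.\<close>
  define A where "A = \<theta>1 / (\<theta>1 - w) * exp (w * b) * upper_gf u"
  define B where "B = \<theta>2 / (\<theta>2 + w) * exp (- w * a) * lower_gf u"
  define C where "C = (\<theta>1 - w)\<^sup>2 * exp (\<beta> * b) / (u * p * \<theta>1 * (\<theta>1 + \<theta>2))"
  define D where "D = (\<theta>2 + w)\<^sup>2 * exp (- \<beta> * a) / (u * (1 - p) * \<theta>2 * (\<theta>1 + \<theta>2))"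
  define P where "P = (\<theta>1 - w) / (\<theta>1 * exp (w * b))"
  define R where "R = (\<theta>2 + w) * exp (w * a) / \<theta>2"
  have C: "C = (\<theta>1 - w) / (\<theta>1 - v) * exp (\<beta> * b)"
    unfolding C_def r(6)[symmetric] v_def[symmetric] using pos by (simp add: power2_eq_square)
  have D: "D = (\<theta>2 + w) / (\<theta>2 + v) * exp (- \<beta> * a)"
    unfolding D_def r(7)[symmetric] v_def[symmetric] using pos by (simp add: power2_eq_square)
  have AB: "A + B = 1"
    unfolding A_def B_def by (rule exit_identity[OF u _ r(3) r(8)]) (use pos in simp)
  have "\<theta>1 / (\<theta>1 - v) * exp (v * b) * upper_gf u + \<theta>2 / (\<theta>2 + v) * exp (- v * a) * lower_gf u = 1"
    by (rule exit_identity[OF u v(1)]) (use pos r(9) in \<open>simp_all add: v_def\<close>)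
  moreover have "A * C = \<theta>1 / (\<theta>1 - v) * exp (v * b) * upper_gf u"
    unfolding A_def C using pos by (simp add: v_def distrib_right exp_add)
  moreover have "B * D = \<theta>2 / (\<theta>2 + v) * exp (- v * a) * lower_gf u"
  proof -
    have "exp (- w * a) * exp (- \<beta> * a) = exp (- v * a)"
    proof -
      have "- w * a + - \<beta> * a = - v * a" by (simp add: v_def algebra_simps)
      then show ?thesis by (simp only: exp_add[symmetric])
    qed
    moreover have "B * D = \<theta>2 / (\<theta>2 + v) * (exp (- w * a) * exp (- \<beta> * a)) * lower_gf u"
      unfolding B_def D using pos by simp
    ultimately show ?thesis by simp
  qed
  ultimately have ABCD: "A * C + B * D = 1" by simp
  \<comment> \<open>The linear system is nonsingular: \<open>C < 1 < D\<close>.\<close>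
  have "C < 1"
  proof -
    have "(\<theta>1 - w) / (\<theta>1 - v) < 1" "0 < (\<theta>1 - w) / (\<theta>1 - v)" using pos wv by auto
    moreover have "exp (\<beta> * b) < 1" using r(1) ab by (simp add: mult_neg_pos)
    ultimately have "(\<theta>1 - w) / (\<theta>1 - v) * exp (\<beta> * b) < 1 * 1"
      by (intro mult_strict_mono) auto
    then show ?thesis unfolding C by simp
  qed
  moreover have "1 < D"
  proof -
    have "1 < (\<theta>2 + w) / (\<theta>2 + v)" using pos wv by auto
    moreover have "1 < exp (- \<beta> * a)" using r(1) ab by (simp add: mult_neg_pos)
    ultimately show ?thesis unfolding D by (rule less_1_mult)
  qed
  ultimately have CD: "C - D \<noteq> 0" by simp
  have B: "B = 1 - A" using AB by simp
  have "A * (C - D) = 1 - D"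
    using ABCD unfolding B by (simp add: algebra_simps)
  then have A: "A = (1 - D) / (C - D)" using CD by (simp add: field_simps)
  have "upper_gf u = A * P"
    unfolding A_def P_def using pos \<theta> by simp
  moreover have "lower_gf u = B * R"
  proof -
    have "exp (- w * a) = 1 / exp (w * a)" by (simp add: exp_minus inverse_eq_divide)
    then show ?thesis unfolding B_def R_def using pos \<theta> by simp
  qed
  ultimately have "upper_gf u + lower_gf u = A * P + (1 - A) * R"
    by (simp only: B)
  also have "\<dots> = (P - R) * (1 - D) / (C - D) + R"
  proof -
    have "A * P + (1 - A) * R = A * (P - R) + R" by (simp add: algebra_simps)
    then show ?thesis unfolding A by simp
  qed
  finally show ?thesis
    unfolding expectation_eq_gf[OF u] P_def R_def C_def D_def .
qed

end
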